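(* Let $A:\mathbb{Z}^{+}\to M_d(\mathbb{R})$ and $f:\mathbb{Z}^{+}\times\mathbb{R}^d\to\mathbb{R}^d$ (with each $f(k,\cdot)$ continuous), and consider the systems $$(L)\quad x_{k+1}=A(k)x_k,\qquad (N)\quad y_{k+1}=A(k)y_k+f(k,y_k),\qquad k\in\mathbb{Z}^{+}.$$ Assume that: (P1) every $A(k)$ is invertible and there exists $M\ge 1$ with $\max\{\sup_{k\in\mathbb{Z}^{+}}\|A(k)\|,\ \sup_{k\in\mathbb{Z}^{+}}\|A^{-1}(k)\|\}=M$. (P2) There exist two invariant projectors $P(\cdot),Q(\cdot)$ with $P(n)+Q(n)=I$ for all $n\in\mathbb{Z}^{+}$, a bounded sequence $\rho$ of nonnegative reals, and a decreasing sequence $h$ of positive reals converging to zero with $h(0)=1$ such that $$\|\Phi(k,n)P(n)\|\le \rho(n)\frac{h(k)}{h(n)}\quad\text{for all } k\ge n\ge 0,\qquad \|\Phi(k,n)Q(n)\|\le \rho(n)\frac{h(n)}{h(k)}\quad\text{for all } 0\le k\le n.$$ (P3) There are sequences $\gamma,\mu$ of nonnegative reals such that for all $k\in\mathbb{Z}^{+}$ and $y,\tilde y\in\mathbb{R}^d$: $|f(k,y)-f(k,\tilde y)|\le\gamma(k)|y-\tilde y|$ and $|f(k,y)|\le\mu(k)$. (P4) There is $p<+\infty$ with $\sum_{j=0}^{\infty}\|\mathcal{G}(\ell,j+1)\|\,\mu(j)\le p$ for all $\ell\in\mathbb{Z}^{+}$. (P5) There is $q<1$ with $\sum_{j=0}^{\infty}\|\mathcal{G}(\ell,j+1)\|\,\gamma(j)\le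 q$ for all $\ell\in\mathbb{Z}^{+}$. (P6) $\|A^{-1}(\ell)\|\,\gamma(\ell)<1$ for all $\ell\in\mathbb{Z}^{+}$. Then the systems $(L)$ and $(N)$ are $\mathbb{Z}^{+}$-topologically equivalent.
   Context: $\mathbb{Z}^{+}=\{0,1,2,\dots\}$; $|\cdot|$ is a vector norm on $\mathbb{R}^d$ and $\|\cdot\|$ its induced matrix norm; $A^{-1}(k)$ denotes $(A(k))^{-1}$. Transition matrix of $(L)$: $\Phi(k,n)=A(k-1)A(k-2)\cdots A(n)$ if $k>n$; $\Phi(k,k)=I$; $\Phi(k,n)=A^{-1}(k)A^{-1}(k+1)\cdots A^{-1}(n-1)$ if $k<n$. Invariant projectors: $P(n),Q(n)\in M_d(\mathbb{R})$ are projections with $P(k)\Phi(k,n)=\Phi(k,n)P(n)$ and $Q(k)\Phi(k,n)=\Phi(k,n)Q(n)$ for all $k,n\in\mathbb{Z}^{+}$. Green's function: $\mathcal{G}(k,n)=\Phi(k,n)P(n)$ for $k\ge n\ge 0$, and $\mathcal{G}(k,n)=-\Phi(k,n)Q(n)$ for $0\le k<n$. Topological equivalence: for $J\subseteq\mathbb{Z}$, the systems $(L)$ and $(N)$ are $J$-topologically equivalent if there is a function $H:J\times\mathbb{R}^d\to\mathbb{R}^d$ such that (i) if $x(k)$ is a solution of $(L)$ then $H[k,x(k)]$ is a solution of $(N)$; (ii) $H(k,u)-u$ is bounded on $J\times\mathbb{R}^d$; (iii) for each fixed $k\in J$, $u\mapsto H(k,u)$ is a homeomorphism of $\mathbb{R}^d$.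 In addition, the function $u\mapsto G(k,u)=H^{-1}(k,u)$ has properties (ii)–(iii) and maps solutions of $(N)$ into solutions of $(L)$. *)

theory Defs
  imports "HOL-Analysis.Analysis"
begin

definition vector_norm :: "('v::real_vector \<Rightarrow> real) \<Rightarrow> bool" where
  "vector_norm N \<longleftrightarrow>
     (\<forall>x. 0 \<le> N x) \<and>
     (\<forall>x. N x = 0 \<longleftrightarrow> x = 0) \<and>
     (\<forall>c x. N (c *\<^sub>R x) = \<bar>c\<bar> * N x) \<and>
     (\<forall>x y. N (x + y) \<le> N x + N y)"

(* The supremum is taken in real; it is meaningful because the unit sphere of a norm N on
   the space of vectors real^'d is nonempty and N (B *v x) is bounded on it. *)
definition induced_norm :: "(real ^ 'd \<Rightarrow> real) \<Rightarrow> real ^ 'd ^ 'd \<Rightarrow> real" where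
  "induced_norm N B = (SUP x\<in>{x. N x = 1}. N (B *v x))"

(* First case: A (k-1) ** ... ** A n, which is the identity for k = n.
   Second case: A^(-1) k ** ... ** A^(-1) (n-1). *)
definition transition :: "(nat \<Rightarrow> real ^ 'd ^ 'd) \<Rightarrow> nat \<Rightarrow> nat \<Rightarrow> real ^ 'd ^ 'd" where
  "transition A k n =
     (if n \<le> k then foldr (\<lambda>i X. A i ** X) (rev [n..<k]) (mat 1)
      else foldr (\<lambda>i X. matrix_inv (A i) ** X) [k..<n] (mat 1))"

definition invariant_projector ::
    "(nat \<Rightarrow> real ^ 'd ^ 'd) \<Rightarrow> (nat \<Rightarrow> real ^ 'd ^ 'd) \<Rightarrow> bool" where
  "invariant_projector A P \<longleftrightarrow>
     (\<forall>n. P n ** P n = P n) \<and>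
     (\<forall>k n. P k ** transition A k n = transition A k n ** P n)"

definition green ::
    "(nat \<Rightarrow> real ^ 'd ^ 'd) \<Rightarrow> (nat \<Rightarrow> real ^ 'd ^ 'd) \<Rightarrow> (nat \<Rightarrow> real ^ 'd ^ 'd) \<Rightarrow>
     nat \<Rightarrow> nat \<Rightarrow> real ^ 'd ^ 'd" where
  "green A P Q k n =
     (if n \<le> k then transition A k n ** P n else - (transition A k n ** Q n))"

(* x (k+1) = F k (x k) is required for those k in J for which k+1 is again in J.
   The index type may be nat or int. *)
definition solution_on ::
    "'i::{plus,one} set \<Rightarrow> ('i \<Rightarrow> 'v \<Rightarrow> 'v) \<Rightarrow> ('i \<Rightarrow> 'v) \<Rightarrow> bool" where
  "solution_on J F x \<longleftrightarrow> (\<forall>k\<in>J. k + 1 \<in> J \<longrightarrow> x (k + 1) = F k (x k))"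

(* Homeomorphisms refer to the standard topology of real^'d, which is the topology
   of every norm N on it. *)
definition conjugating_map ::
    "(real ^ 'd \<Rightarrow> real) \<Rightarrow> 'i::{plus,one} set \<Rightarrow>
     ('i \<Rightarrow> real ^ 'd \<Rightarrow> real ^ 'd) \<Rightarrow> ('i \<Rightarrow> real ^ 'd \<Rightarrow> real ^ 'd) \<Rightarrow>
     ('i \<Rightarrow> real ^ 'd \<Rightarrow> real ^ 'd) \<Rightarrow> bool" where
  "conjugating_map N J F F' H \<longleftrightarrow>
     (\<forall>x. solution_on J F x \<longrightarrow> solution_on J F' (\<lambda>k. H k (x k))) \<and>
     (\<exists>B. \<forall>k\<in>J. \<forall>u. N (H k u - u) \<le> B) \<and>
     (\<forall>k\<in>J. \<exists>g. homeomorphism UNIV UNIV (H k) g)"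

definition topologically_equivalent ::
    "(real ^ 'd \<Rightarrow> real) \<Rightarrow> 'i::{plus,one} set \<Rightarrow>
     ('i \<Rightarrow> real ^ 'd \<Rightarrow> real ^ 'd) \<Rightarrow> ('i \<Rightarrow> real ^ 'd \<Rightarrow> real ^ 'd) \<Rightarrow> bool" where
  "topologically_equivalent N J F F' \<longleftrightarrow>
     (\<exists>H. conjugating_map N J F F' H \<and> conjugating_map N J F' F (\<lambda>k. inv (H k)))"

end

theory Submission
  imports Defs
begin

text \<open>
  The Green's function turns the bounded perturbation into a bounded correction of solutions.  For
  any sequence \<open>y\<close> put \<open>(K y) k = (\<Sum>j. green A P Q k (j + 1) *v f j (y j))\<close>.
  Because \<open>P + Q\<close> is the identity, \<open>K y\<close> solves the linear equation with forcing term
  \<open>f k (y k)\<close> (\<open>green_sum_Suc\<close>).  Hence \<open>y\<close> solves the perturbed system exactly when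
  \<open>y - K y\<close> solves the linear one (\<open>solution_perturbed_iff\<close>).

  The sums against \<open>\<mu>\<close> bound \<open>K\<close> by \<open>p\<close>, and the sums against \<open>\<gamma>\<close> make it a
  contraction with factor \<open>q\<close> in the supremum distance.  So for each sequence \<open>x\<close> the equation
  \<open>y - K y = x\<close> has exactly one solution \<open>y\<close>, and \<open>y \<mapsto> y - K y\<close> is a bijection between
  the solutions of the two systems that moves every point by at most \<open>p\<close>.

  It remains to pass from solutions to points.  Through each \<open>u\<close> at each time \<open>k\<close> there
  passes exactly one solution of either system, since all one-step maps are bijective; for the
  perturbed system this is the condition that \<open>\<gamma> l\<close> times the norm of the inverse of
  \<open>A l\<close> is less than one (\<open>bij_lipschitz_perturbation\<close>).  Evaluating the correspondence of
  solutions at time \<open>k\<close> gives a bijection \<open>linearize k\<close> of the space.  It is continuous as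
  a uniform limit of partial sums by the Weierstrass test, and invariance of domain makes it a
  homeomorphism.  Its inverse is the conjugacy from the linear to the perturbed system, so
  continuous dependence of the fixed point \<open>y\<close> on \<open>x\<close> need not be studied directly.
\<close>

section \<open>Vector norms and their induced matrix norms\<close>

lemma vector_norm_nonneg: "vector_norm N \<Longrightarrow> 0 \<le> N x"
  and vector_norm_eq_0: "vector_norm N \<Longrightarrow> N x = 0 \<longleftrightarrow> x = 0"
  and vector_norm_scaleR: "vector_norm N \<Longrightarrow> N (c *\<^sub>R x) = \<bar>c\<bar> * N x"
  and vector_norm_triangle: "vector_norm N \<Longrightarrow> N (x + y) \<le> N x + N y"
  by (auto simp: vector_norm_def)

lemma vector_norm_zero: "vector_norm N \<Longrightarrow> N 0 = 0"
  by (simp add: vector_norm_eq_0)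

lemma vector_norm_minus: "vector_norm N \<Longrightarrow> N (- x) = N x"
  using vector_norm_scaleR[of N "-1" x] by simp

lemma vector_norm_diff_commute: "vector_norm N \<Longrightarrow> N (x - y) = N (y - x)"
  using vector_norm_minus[of N "x - y"] by simp

lemma vector_norm_triangle_diff:
  assumes "vector_norm N" shows "N (x - z) \<le> N (x - y) + N (y - z)"
  using vector_norm_triangle[OF assms, of "x - y" "y - z"] by simp

lemma vector_norm_sum:
  assumes "vector_norm N" shows "N (sum g S) \<le> (\<Sum>i\<in>S. N (g i))"
proof (induction S rule: infinite_finite_induct)
  case (insert x S)
  then show ?case using vector_norm_triangle[OF assms, of "g x" "sum g S"] by simp
qed (simp_all add: vector_norm_zero[OF assms])

lemma vector_norm_le_norm:
  fixes N :: "'v::euclidean_space \<Rightarrow> real"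
  assumes "vector_norm N"
  obtains C where "0 < C" "\<And>x. N x \<le> C * norm x"
proof
  define C where "C = (\<Sum>b\<in>Basis. N b) + 1"
  show "0 < C"
    using sum_nonneg[of "Basis" N] vector_norm_nonneg[OF assms] by (simp add: C_def add_nonneg_pos)
  fix x :: 'v
  have "N x = N (\<Sum>b\<in>Basis. (x \<bullet> b) *\<^sub>R b)" by (simp add: euclidean_representation)
  also have "\<dots> \<le> (\<Sum>b\<in>Basis. N ((x \<bullet> b) *\<^sub>R b))" by (rule vector_norm_sum[OF assms])
  also have "\<dots> = (\<Sum>b\<in>Basis. \<bar>x \<bullet> b\<bar> * N b)" by (simp add: vector_norm_scaleR[OF assms])
  also have "\<dots> \<le> (\<Sum>b\<in>Basis. norm x * N b)"
    by (intro sum_mono mult_right_mono Basis_le_norm vector_norm_nonneg[OF assms])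
  also have "\<dots> = norm x * (\<Sum>b\<in>Basis. N b)" by (simp add: sum_distrib_left)
  also have "\<dots> \<le> C * norm x" by (simp add: C_def algebra_simps)
  finally show "N x \<le> C * norm x" .
qed

lemma continuous_on_vector_norm:
  fixes N :: "'v::euclidean_space \<Rightarrow> real"
  assumes "vector_norm N"
  shows "continuous_on S N"
proof -
  obtain C where C: "0 < C" "\<And>x. N x \<le> C * norm x" using vector_norm_le_norm[OF assms] by blast
  have "dist (N x) (N y) \<le> C * dist x y" for x y
    using vector_norm_triangle[OF assms, of "x - y" y] vector_norm_triangle[OF assms, of "y - x" x]
      vector_norm_diff_commute[OF assms, of x y] C(2)[of "x - y"]
    by (simp add: dist_norm abs_if)
  then have "C-lipschitz_on S N" using C(1) by (intro lipschitz_onI) auto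
  then show ?thesis by (rule lipschitz_on_continuous_on)
qed

text \<open>
  All norms are equivalent in finite dimension: on the compact Euclidean unit sphere the
  continuous function \<^term>\<open>N\<close> attains its minimum, which is positive.
\<close>

lemma norm_le_vector_norm:
  fixes N :: "'v::euclidean_space \<Rightarrow> real"
  assumes "vector_norm N"
  obtains c where "0 < c" "\<And>x. norm x \<le> c * N x"
proof -
  have "compact (sphere (0::'v) 1)" "sphere (0::'v) 1 \<noteq> {}" by auto
  then obtain s where s: "s \<in> sphere 0 1" "\<And>y. y \<in> sphere 0 1 \<Longrightarrow> N s \<le> N y"
    using continuous_attains_inf[OF _ _ continuous_on_vector_norm[OF assms]] by metis
  have pos: "0 < N s"
    using s(1) vector_norm_nonneg[OF assms, of s] vector_norm_eq_0[OF assms, of s]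
    by (cases "s = 0") auto
  have "norm x \<le> inverse (N s) * N x" for x
  proof (cases "x = 0")
    case False
    then have "N s \<le> N ((1 / norm x) *\<^sub>R x)" by (intro s(2)) simp
    also have "\<dots> = N x / norm x" by (simp add: vector_norm_scaleR[OF assms])
    finally show ?thesis using pos False by (simp add: field_simps)
  qed (simp add: vector_norm_zero[OF assms])
  with pos show ?thesis by (intro that[of "inverse (N s)"]) auto
qed

lemma vector_norm_unit_sphere_nonempty:
  fixes N :: "'v::euclidean_space \<Rightarrow> real"
  assumes "vector_norm N"
  shows "{x. N x = 1} \<noteq> {}"
proof -
  obtain b :: 'v where "b \<in> Basis" using SOME_Basis by blast
  then have "N b \<noteq> 0" by (simp add: vector_norm_eq_0[OF assms] nonzero_Basis)
  then have "N ((1 / N b) *\<^sub>R b) = 1"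
    using vector_norm_nonneg[OF assms, of b] by (simp add: vector_norm_scaleR[OF assms])
  then show ?thesis by blast
qed

text \<open>
  A real supremum is an upper bound only of a set that is bounded above; this lemma gives
  \<^const>\<open>induced_norm\<close> its meaning.
\<close>

lemma bdd_above_induced_norm:
  fixes B :: "real ^ 'd ^ 'd"
  assumes "vector_norm N"
  shows "bdd_above ((\<lambda>x. N (B *v x)) ` {x. N x = 1})"
proof -
  obtain C where C: "0 < C" "\<And>x. N x \<le> C * norm x" using vector_norm_le_norm[OF assms] by blast
  obtain c where c: "0 < c" "\<And>x. norm x \<le> c * N x" using norm_le_vector_norm[OF assms] by blast
  have "N (B *v x) \<le> C * (onorm ((*v) B) * c)" if "N x = 1" for x
  proof -
    have "norm (B *v x) \<le> onorm ((*v) B) * norm x" by (rule onorm) simp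
    also have "\<dots> \<le> onorm ((*v) B) * c"
      using c(2)[of x] that by (intro mult_left_mono onorm_pos_le) auto
    finally have "C * norm (B *v x) \<le> C * (onorm ((*v) B) * c)" using C(1) by simp
    with C(2)[of "B *v x"] show ?thesis by linarith
  qed
  then show ?thesis by (intro bdd_aboveI2) auto
qed

lemma vector_norm_mult_le_induced_norm:
  assumes "vector_norm N"
  shows "N (B *v x) \<le> induced_norm N B * N x"
proof (cases "x = 0")
  case False
  then have pos: "0 < N x"
    using vector_norm_nonneg[OF assms, of x] vector_norm_eq_0[OF assms, of x] by linarith
  then have "N ((1 / N x) *\<^sub>R x) = 1" by (simp add: vector_norm_scaleR[OF assms])
  then have "N (B *v ((1 / N x) *\<^sub>R x)) \<le> induced_norm N B"
    unfolding induced_norm_def by (intro cSUP_upper bdd_above_induced_norm[OF assms]) auto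
  then have "N (B *v x) / N x \<le> induced_norm N B"
    using pos by (simp add: matrix_vector_mult_scaleR vector_norm_scaleR[OF assms])
  then show ?thesis using pos by (simp add: field_simps)
qed (simp add: vector_norm_zero[OF assms])

lemma induced_norm_nonneg:
  assumes "vector_norm N"
  shows "0 \<le> induced_norm N B"
proof -
  obtain x where x: "N x = 1" using vector_norm_unit_sphere_nonempty[OF assms] by auto
  then have "N (B *v x) \<le> induced_norm N B"
    using vector_norm_mult_le_induced_norm[OF assms, of B x] by simp
  then show ?thesis using vector_norm_nonneg[OF assms, of "B *v x"] by linarith
qed

text \<open>
  The comparison test and the triangle inequality for series hold with the norm \<^term>\<open>N\<close> in
  place of the Euclidean norm.  The Euclidean norm would only give the second part up to a constant,
  which would destroy the contraction factor.
\<close>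

lemma summable_vector_norm_comparison:
  fixes N :: "'v::euclidean_space \<Rightarrow> real"
  assumes N: "vector_norm N" and g: "summable g" and le: "\<And>j. N (a j) \<le> g j"
  shows "summable a" "N (suminf a) \<le> suminf g"
proof -
  obtain c where c: "0 < c" "\<And>x. norm x \<le> c * N x" using norm_le_vector_norm[OF N] by blast
  have dominated: "norm (a j) \<le> c * g j" for j
    using c(2)[of "a j"] mult_left_mono[OF le[of j], of c] c(1) by linarith
  show s: "summable a"
    by (rule summable_comparison_test'[OF summable_mult[OF g, of c], of 0]) (rule dominated)
  have "(\<lambda>n. N (\<Sum>j<n. a j)) \<longlonglongrightarrow> N (suminf a)"
    using continuous_on_vector_norm[OF N, of UNIV] summable_LIMSEQ[OF s]
    by (auto intro!: isCont_tendsto_compose[of _ N] simp: continuous_on_eq_continuous_at)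
  moreover have "N (\<Sum>j<n. a j) \<le> (\<Sum>j<n. g j)" for n
    using vector_norm_sum[OF N, of a "{..<n}"] sum_mono[of "{..<n}", OF le] by (rule order_trans)
  ultimately show "N (suminf a) \<le> suminf g"
    using summable_LIMSEQ[OF g] by (intro LIMSEQ_le) auto
qed

section \<open>Contractions in the supremum distance of a vector norm\<close>

text \<open>
  This is the Banach fixed point theorem for families of vectors at finite distance from each
  other.  The family \<^term>\<open>z0\<close> itself may be unbounded, as the orbits of a linear system are, so
  the distances are bounded by explicit constants instead of being measured in a space of bounded
  functions.  An index type with one element gives the usual statement on a single space.
\<close>

lemma sup_contraction_has_fixpoint:
  fixes N :: "'v::euclidean_space \<Rightarrow> real" and T :: "('i \<Rightarrow> 'v) \<Rightarrow> 'i \<Rightarrow> 'v"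
  assumes N: "vector_norm N" and q: "0 \<le> q" "q < 1"
    and contr: "\<And>z w c i. (\<And>j. N (z j - w j) \<le> c) \<Longrightarrow> N (T z i - T w i) \<le> q * c"
    and start: "\<And>i. N (T z0 i - z0 i) \<le> b"
  obtains z where "T z = z"
proof -
  define Z where "Z n = (T ^^ n) z0" for n
  have Z_Suc: "Z (Suc n) = T (Z n)" for n by (simp add: Z_def)
  have step: "N (Z (Suc n) i - Z n i) \<le> q ^ n * b" for n i
  proof (induction n arbitrary: i)
    case (Suc n)
    then show ?case using contr[of "Z (Suc n)" "Z n"] by (simp add: Z_Suc mult.assoc)
  qed (simp add: Z_def start)
  define D where "D i = (\<lambda>n. Z (Suc n) i - Z n i)" for i
  have geo: "summable (\<lambda>n. q ^ (n + m) * b)" for m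
    using q by (intro summable_mult2 summable_ignore_initial_segment[OF summable_geometric]) auto
  have summable_D: "summable (D i)" for i
    using summable_vector_norm_comparison(1)[OF N geo[of 0], of "D i"] step by (simp add: D_def)
  define z where "z i = z0 i + suminf (D i)" for i
  define B where "B = b / (1 - q)"
  \<comment> \<open>The remainder of the geometric series that dominates \<open>D i\<close>, uniform in the index.\<close>
  have tail: "N (z i - Z m i) \<le> q ^ m * B" for i m
  proof -
    have "(\<Sum>n<m. D i n) = Z m i - z0 i"
      using sum_lessThan_telescope[of "\<lambda>n. Z n i" m] by (simp add: D_def Z_def)
    then have "z i - Z m i = (\<Sum>n. D i (n + m))"
      using suminf_minus_initial_segment[OF summable_D[of i], of m] by (simp add: z_def)
    also have "N \<dots> \<le> (\<Sum>n. q ^ (n + m) * b)"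
      by (rule summable_vector_norm_comparison(2)[OF N geo]) (use step in \<open>simp add: D_def\<close>)
    also have "\<dots> = (\<Sum>n. q ^ n * (q ^ m * b))" by (simp add: power_add mult.assoc)
    also have "\<dots> = (\<Sum>n. q ^ n) * (q ^ m * b)"
      using q by (intro suminf_mult2[symmetric] summable_geometric) auto
    also have "\<dots> = q ^ m * B" using q by (simp add: suminf_geometric B_def)
    finally show ?thesis .
  qed
  have "T z i = z i" for i
  proof -
    have "N (T z i - z i) \<le> q ^ m * (2 * q * B)" for m
    proof -
      have "N (T z i - Z (Suc m) i) \<le> q * (q ^ m * B)"
        unfolding Z_Suc by (rule contr) (rule tail)
      then show ?thesis
        using vector_norm_triangle_diff[OF N, of "T z i" "z i" "Z (Suc m) i"] tail[of i "Suc m"]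
          vector_norm_diff_commute[OF N, of "z i" "Z (Suc m) i"]
        by (simp add: algebra_simps)
    qed
    moreover have "(\<lambda>m. q ^ m * (2 * q * B)) \<longlonglongrightarrow> 0"
      using q by (intro tendsto_mult_left_zero LIMSEQ_realpow_zero) auto
    ultimately have "N (T z i - z i) \<le> 0" by (intro LIMSEQ_le_const) auto
    then show ?thesis
      using vector_norm_nonneg[OF N, of "T z i - z i"] vector_norm_eq_0[OF N, of "T z i - z i"]
      by simp
  qed
  then show ?thesis by (intro that[of z]) auto
qed

lemma sup_contraction_fixpoint_unique:
  fixes N :: "'v::real_vector \<Rightarrow> real" and T :: "('i \<Rightarrow> 'v) \<Rightarrow> 'i \<Rightarrow> 'v"
  assumes N: "vector_norm N" and q: "0 \<le> q" "q < 1"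
    and contr: "\<And>z w c i. (\<And>j. N (z j - w j) \<le> c) \<Longrightarrow> N (T z i - T w i) \<le> q * c"
    and fixpoints: "T z = z" "T w = w"
    and near: "\<And>i. N (z i - w i) \<le> b"
  shows "z = w"
proof
  fix i
  have "N (z i - w i) \<le> q ^ n * b" for n i
  proof (induction n arbitrary: i)
    case (Suc n)
    then show ?case using contr[of z w "q ^ n * b" i] fixpoints by (simp add: mult.assoc)
  qed (simp add: near)
  moreover have "(\<lambda>n. q ^ n * b) \<longlonglongrightarrow> 0"
    using q by (intro tendsto_mult_left_zero LIMSEQ_realpow_zero) auto
  ultimately have "N (z i - w i) \<le> 0" by (intro LIMSEQ_le_const) auto
  then show "z i = w i"
    using vector_norm_nonneg[OF N, of "z i - w i"] vector_norm_eq_0[OF N, of "z i - w i"] by simp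
qed

section \<open>Orbits of an invertible nonautonomous recursion\<close>

text \<open>
  By invariance of domain the inverse of a continuous bijection of a Euclidean space is
  automatically continuous.
\<close>

lemma continuous_bij_homeomorphism:
  fixes F :: "'v::euclidean_space \<Rightarrow> 'v"
  assumes "continuous_on UNIV F" "bij F"
  shows "homeomorphism UNIV UNIV F (inv F)"
  using assms continuous_on_inverse_open[OF open_UNIV assms(1), of "inv F"]
  by (auto simp: homeomorphism_def bij_def surj_imp_inj_inv inj_imp_surj_inv surj_f_inv_f inv_f_f)

primrec orbit :: "(nat \<Rightarrow> 'v \<Rightarrow> 'v) \<Rightarrow> nat \<Rightarrow> 'v \<Rightarrow> 'v" where
  "orbit F 0 u = u"
| "orbit F (Suc k) u = F k (orbit F k u)"

text \<open>
  One formula covers times before and after \<^term>\<open>k\<close>: go back to time zero, then forward.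
  The inverse is meaningful when all the maps \<^term>\<open>F k\<close> are bijective.
\<close>

definition solution_through :: "(nat \<Rightarrow> 'v \<Rightarrow> 'v) \<Rightarrow> nat \<Rightarrow> 'v \<Rightarrow> nat \<Rightarrow> 'v" where
  "solution_through F k u j = orbit F j (inv (orbit F k) u)"

lemma solution_on_UNIV_iff: "solution_on UNIV F x \<longleftrightarrow> (\<forall>k::nat. x (Suc k) = F k (x k))"
  by (simp add: solution_on_def)

lemma bij_orbit:
  assumes "\<And>k. bij (F k)" shows "bij (orbit F k)"
proof (induction k)
  case 0
  have "orbit F 0 = id" by auto
  then show ?case by (simp only: bij_id)
next
  case (Suc k)
  have "orbit F (Suc k) = F k \<circ> orbit F k" by auto
  then show ?case using Suc assms bij_comp by metis
qed

lemma solution_on_solution_through: "solution_on UNIV F (solution_through F k u)"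
  by (simp add: solution_on_UNIV_iff solution_through_def)

lemma solution_through_at:
  assumes "\<And>k. bij (F k)" shows "solution_through F k u k = u"
  using bij_orbit[of F k, OF assms] by (simp add: solution_through_def bij_def surj_f_inv_f)

lemma solution_through_solution:
  assumes bij: "\<And>k. bij (F k)" and sol: "solution_on UNIV F y"
  shows "solution_through F k (y k) = y"
proof -
  have "y j = orbit F j (y 0)" for j
    using sol by (induction j) (simp_all add: solution_on_UNIV_iff)
  then show ?thesis
    using bij_orbit[of F k, OF bij]
    by (metis (no_types, lifting) bij_def ext inv_f_f solution_through_def)
qed

lemma continuous_on_solution_through:
  fixes F :: "nat \<Rightarrow> 'v::euclidean_space \<Rightarrow> 'v"
  assumes cont: "\<And>k. continuous_on UNIV (F k)" and bij: "\<And>k. bij (F k)"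
  shows "continuous_on UNIV (\<lambda>u. solution_through F k u j)"
proof -
  have orb: "continuous_on UNIV (orbit F k)" for k
    by (induction k)
      (auto intro: continuous_on_compose2[OF cont] continuous_on_id)
  have "continuous_on UNIV (inv (orbit F k))"
    using continuous_bij_homeomorphism[OF orb bij_orbit[of F, OF bij]]
    by (simp add: homeomorphism_def)
  then show ?thesis
    unfolding solution_through_def by (rule continuous_on_compose2[OF orb]) simp
qed

section \<open>Transition matrices and the Green's function\<close>

lemma matrix_inv_right_left:
  assumes "invertible A" shows "A ** matrix_inv A = mat 1" "matrix_inv A ** A = mat 1"
  using someI_ex[OF assms[unfolded invertible_def]] by (auto simp: matrix_inv_def)

lemma bij_matrix_vector_mult:
  fixes A :: "real ^ 'd ^ 'd"
  assumes "invertible A" shows "bij ((*v) A)"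
  by (rule bij_betw_byWitness[where f' = "(*v) (matrix_inv A)"])
    (auto simp: matrix_vector_mul_assoc matrix_inv_right_left[OF assms])

lemma transition_Suc:
  fixes A :: "nat \<Rightarrow> real ^ 'd ^ 'd"
  assumes "invertible (A k)"
  shows "transition A (Suc k) n = A k ** transition A k n"
proof (cases "n \<le> k")
  case False
  then have "[k..<n] = k # [Suc k..<n]" by (simp add: upt_conv_Cons)
  moreover have "A k ** (matrix_inv (A k) ** X) = X" for X :: "real ^ 'd ^ 'd"
    by (simp add: matrix_mul_assoc matrix_inv_right_left[OF assms])
  ultimately show ?thesis using False by (auto simp: transition_def)
qed (simp add: transition_def)

lemma matrix_mul_minus_right:
  fixes A :: "real ^ 'n ^ 'm" and B :: "real ^ 'k ^ 'n"
  shows "A ** (- B) = - (A ** B)"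
  by (simp add: matrix_matrix_mult_def vec_eq_iff sum_negf)

text \<open>
  As a function of its first argument the Green's function follows the linear recursion, except for
  a unit jump on the diagonal, where the recursion would give \<^term>\<open>- Q n\<close> but the value is
  \<^term>\<open>P n\<close>.
\<close>

lemma green_Suc:
  fixes A :: "nat \<Rightarrow> real ^ 'd ^ 'd"
  assumes inv: "invertible (A k)" and PQ: "P (Suc k) + Q (Suc k) = mat 1"
  shows "green A P Q (Suc k) (Suc j) = A k ** green A P Q k (Suc j) + (if j = k then mat 1 else 0)"
proof (cases "j = k")
  case True
  have "transition A (Suc k) (Suc k) = mat 1" by (simp add: transition_def)
  then have "A k ** transition A k (Suc k) = mat 1"
    by (simp only: transition_Suc[of A k "Suc k", OF inv])
  then have "A k ** green A P Q k (Suc k) = - Q (Suc k)"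
    by (simp add: green_def matrix_mul_assoc matrix_mul_minus_right)
  moreover have "green A P Q (Suc k) (Suc k) = P (Suc k)" by (simp add: green_def transition_def)
  ultimately show ?thesis using True PQ by (simp add: algebra_simps)
next
  case False
  then show ?thesis
    by (auto simp: green_def transition_Suc[of A k, OF inv] matrix_mul_assoc matrix_mul_minus_right)
qed

section \<open>Lipschitz perturbations of an invertible matrix\<close>

text \<open>
  The equation \<^prop>\<open>A *v y + g y = w\<close> says that \<^term>\<open>y\<close> is a fixed point of the
  map \<^term>\<open>\<lambda>y. matrix_inv A *v (w - g y)\<close>, which is a contraction.
\<close>

lemma bij_lipschitz_perturbation:
  fixes A :: "real ^ 'd ^ 'd"
  assumes N: "vector_norm N" and inv: "invertible A"
    and lip: "\<And>y y'. N (g y - g y') \<le> c * N (y - y')"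
    and small: "0 \<le> c" "induced_norm N (matrix_inv A) * c < 1"
  shows "bij (\<lambda>y. A *v y + g y)"
proof -
  define q where "q = induced_norm N (matrix_inv A) * c"
  have q: "0 \<le> q" "q < 1"
    using small induced_norm_nonneg[OF N] by (auto simp: q_def)
  define T where "T w y = (\<lambda>i::unit. matrix_inv A *v (w - g (y i)))" for w y
  have contr: "N (T w y i - T w y' i) \<le> q * b" if "\<And>j. N (y j - y' j) \<le> b" for w y y' b i
  proof -
    have "T w y i - T w y' i = matrix_inv A *v (g (y' i) - g (y i))"
      by (simp add: T_def matrix_vector_mult_diff_distrib)
    then have "N (T w y i - T w y' i) \<le> induced_norm N (matrix_inv A) * N (g (y' i) - g (y i))"
      using vector_norm_mult_le_induced_norm[OF N] by simp
    also have "\<dots> \<le> induced_norm N (matrix_inv A) * (c * b)"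
    proof (intro mult_left_mono induced_norm_nonneg[OF N])
      show "N (g (y' i) - g (y i)) \<le> c * b"
        using lip[of "y' i" "y i"] mult_left_mono[OF that[of i] small(1)]
        unfolding vector_norm_diff_commute[OF N, of "y i" "y' i"] by (rule order_trans)
    qed
    finally show ?thesis by (simp add: q_def mult.assoc)
  qed
  have solves: "T w y = y \<longleftrightarrow> A *v y () + g (y ()) = w" for w y
  proof -
    have "T w y = y \<longleftrightarrow> matrix_inv A *v (w - g (y ())) = y ()" by (auto simp: T_def fun_eq_iff)
    also have "\<dots> \<longleftrightarrow> w - g (y ()) = A *v y ()"
      by (metis matrix_vector_mul_assoc matrix_vector_mul_lid matrix_inv_right_left[OF inv])
    finally show ?thesis by (auto simp: algebra_simps)
  qed
  show ?thesis
  proof (rule bijI)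
    show "inj (\<lambda>y. A *v y + g y)"
    proof (rule injI)
      fix y y' assume eq: "A *v y + g y = A *v y' + g y'"
      define w where "w = A *v y + g y"
      have fixpoints: "T w (\<lambda>_. y) = (\<lambda>_. y)" "T w (\<lambda>_. y') = (\<lambda>_. y')"
        using solves eq by (auto simp: w_def)
      have "(\<lambda>_::unit. y) = (\<lambda>_. y')"
        by (rule sup_contraction_fixpoint_unique[where T = "T w" and b = "N (y - y')", OF N q])
          (rule contr fixpoints order_refl, assumption?)+
      then show "y = y'" by (simp add: fun_eq_iff)
    qed
    show "surj (\<lambda>y. A *v y + g y)"
      unfolding surj_def
    proof
      fix w
      have start: "N (T w (\<lambda>_. 0) i - 0) \<le> N (T w (\<lambda>_. 0) ())" for i by simp
      obtain y where "T w y = y"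
        by (rule sup_contraction_has_fixpoint[where T = "T w" and ?z0.0 = "\<lambda>_. 0", OF N q _ start])
          (rule contr, assumption)
      then show "\<exists>y. w = A *v y + g y" using solves[of w y] by metis
    qed
  qed
qed

section \<open>The conjugacy defined by the Green's function\<close>

locale green_perturbation =
  fixes N :: "real ^ 'd \<Rightarrow> real"
    and A P Q :: "nat \<Rightarrow> real ^ 'd ^ 'd"
    and f :: "nat \<Rightarrow> real ^ 'd \<Rightarrow> real ^ 'd"
    and p q :: real
    and \<gamma> \<mu> :: "nat \<Rightarrow> real"
  assumes norm: "vector_norm N"
    and cont: "\<And>k. continuous_on UNIV (f k)"
    and inv_A: "\<And>k. invertible (A k)"
    and PQ: "\<And>n. P n + Q n = mat 1"
    and gamma_nonneg: "\<And>k. 0 \<le> \<gamma> k"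
    and lipschitz: "\<And>k y y'. N (f k y - f k y') \<le> \<gamma> k * N (y - y')"
    and bound: "\<And>k y. N (f k y) \<le> \<mu> k"
    and mu_summable: "\<And>l. summable (\<lambda>j. induced_norm N (green A P Q l (j + 1)) * \<mu> j)"
    and mu_sum: "\<And>l. (\<Sum>j. induced_norm N (green A P Q l (j + 1)) * \<mu> j) \<le> p"
    and gamma_summable: "\<And>l. summable (\<lambda>j. induced_norm N (green A P Q l (j + 1)) * \<gamma> j)"
    and gamma_sum: "\<And>l. (\<Sum>j. induced_norm N (green A P Q l (j + 1)) * \<gamma> j) \<le> q"
    and q_less_1: "q < 1"
    and invertible_step: "\<And>l. induced_norm N (matrix_inv (A l)) * \<gamma> l < 1"
begin

abbreviation linear_step :: "nat \<Rightarrow> real ^ 'd \<Rightarrow> real ^ 'd" where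
  "linear_step k x \<equiv> A k *v x"

abbreviation perturbed_step :: "nat \<Rightarrow> real ^ 'd \<Rightarrow> real ^ 'd" where
  "perturbed_step k y \<equiv> A k *v y + f k y"

definition green_sum :: "(nat \<Rightarrow> real ^ 'd) \<Rightarrow> nat \<Rightarrow> real ^ 'd" where
  "green_sum y k = (\<Sum>j. green A P Q k (j + 1) *v f j (y j))"

lemma q_nonneg: "0 \<le> q"
  using suminf_nonneg[OF gamma_summable[of 0]] gamma_sum[of 0]
    induced_norm_nonneg[OF norm] gamma_nonneg by (meson mult_nonneg_nonneg order_trans)

lemma green_term_bound:
  "N (green A P Q k (j + 1) *v f j u) \<le> induced_norm N (green A P Q k (j + 1)) * \<mu> j"
  using vector_norm_mult_le_induced_norm[OF norm] mult_left_mono[OF bound induced_norm_nonneg[OF norm]]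
  by (rule order_trans)

lemma green_sum_summable: "summable (\<lambda>j. green A P Q k (j + 1) *v f j (y j))"
  by (rule summable_vector_norm_comparison(1)[OF norm mu_summable green_term_bound])

lemma green_sum_bound: "N (green_sum y k) \<le> p"
  unfolding green_sum_def
  using summable_vector_norm_comparison(2)[OF norm mu_summable green_term_bound] mu_sum
  by (rule order_trans)

lemma green_sum_contraction:
  assumes "\<And>j. N (y j - w j) \<le> c"
  shows "N (green_sum y k - green_sum w k) \<le> q * c"
proof -
  let ?g = "\<lambda>j. induced_norm N (green A P Q k (j + 1)) * \<gamma> j"
  have c: "0 \<le> c" using assms[of 0] vector_norm_nonneg[OF norm, of "y 0 - w 0"] by linarith
  have "green_sum y k - green_sum w k
      = (\<Sum>j. green A P Q k (j + 1) *v (f j (y j) - f j (w j)))"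
    unfolding green_sum_def
    by (simp only: suminf_diff[OF green_sum_summable green_sum_summable]
        matrix_vector_mult_diff_distrib)
  also have "N \<dots> \<le> (\<Sum>j. ?g j * c)"
  proof (rule summable_vector_norm_comparison(2)[OF norm])
    show "summable (\<lambda>j. ?g j * c)" by (intro summable_mult2 gamma_summable)
    fix j
    have "N (f j (y j) - f j (w j)) \<le> \<gamma> j * c"
      using lipschitz[of j "y j" "w j"] mult_left_mono[OF assms[of j] gamma_nonneg[of j]] by linarith
    then have "induced_norm N (green A P Q k (j + 1)) * N (f j (y j) - f j (w j)) \<le> ?g j * c"
      using mult_left_mono[OF _ induced_norm_nonneg[OF norm]] by (simp add: mult.assoc)
    then show "N (green A P Q k (j + 1) *v (f j (y j) - f j (w j))) \<le> ?g j * c"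
      using vector_norm_mult_le_induced_norm[OF norm] order_trans by blast
  qed
  also have "\<dots> = (\<Sum>j. ?g j) * c" by (rule suminf_mult2[symmetric, OF gamma_summable])
  also have "\<dots> \<le> q * c" by (rule mult_right_mono[OF gamma_sum c])
  finally show ?thesis .
qed

text \<open>
  Every term of the sum is propagated by \<^term>\<open>A k\<close>; the term with index \<^term>\<open>k\<close> crosses
  the diagonal of the Green's function and contributes the jump, which is the forcing term.
\<close>

lemma green_sum_Suc: "green_sum y (Suc k) = A k *v green_sum y k + f k (y k)"
proof -
  let ?a = "\<lambda>j. green A P Q k (j + 1) *v f j (y j)"
  have "(\<lambda>j. A k *v ?a j) sums (A k *v green_sum y k)"
    unfolding green_sum_def
    by (intro bounded_linear.sums[OF matrix_vector_mul_bounded_linear]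
        summable_sums green_sum_summable)
  moreover have "(\<lambda>j. if j = k then f j (y j) else 0) sums f k (y k)"
    by (rule sums_single)
  ultimately have "(\<lambda>j. A k *v ?a j + (if j = k then f j (y j) else 0))
      sums (A k *v green_sum y k + f k (y k))" by (rule sums_add)
  moreover have "green A P Q (Suc k) (j + 1) *v f j (y j)
      = A k *v ?a j + (if j = k then f j (y j) else 0)" for j
    using green_Suc[of A k P Q j, OF inv_A PQ]
    by (simp add: matrix_vector_mult_add_rdistrib matrix_vector_mul_assoc)
  ultimately show ?thesis unfolding green_sum_def by (simp add: sums_iff)
qed

lemma solution_perturbed_iff:
  "solution_on UNIV perturbed_step y \<longleftrightarrow> solution_on UNIV linear_step (\<lambda>k. y k - green_sum y k)"
  by (auto simp: solution_on_UNIV_iff green_sum_Suc matrix_vector_mult_diff_distrib algebra_simps)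

text \<open>
  The solution is the fixed point of \<^term>\<open>\<lambda>y k. x k + green_sum y k\<close>.  The sequence
  \<^term>\<open>x\<close> is arbitrary, possibly unbounded; the iteration starts at \<^term>\<open>x\<close>,
  which the map moves by at most \<^term>\<open>p\<close>.
\<close>

lemma green_equation_solvable:
  obtains y where "\<And>k. y k - green_sum y k = x k"
proof -
  have "N ((x k + green_sum y k) - (x k + green_sum w k)) \<le> q * c"
    if "\<And>j. N (y j - w j) \<le> c" for y w c k
    using green_sum_contraction[OF that] by simp
  moreover have "N ((x k + green_sum x k) - x k) \<le> p" for k
    using green_sum_bound by simp
  ultimately obtain y where "(\<lambda>k. x k + green_sum y k) = y"
    using sup_contraction_has_fixpoint[OF norm q_nonneg q_less_1,
        of "\<lambda>y k. x k + green_sum y k" x p] by blast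
  then have "y k - green_sum y k = x k" for k by (metis add_diff_cancel_right')
  then show ?thesis by (rule that)
qed

text \<open>
  Two solutions differ by two values of \<^const>\<open>green_sum\<close>, hence by at most
  \<^term>\<open>p + p\<close>.  This finite distance is what lets the contraction force them to agree.
\<close>

lemma green_equation_unique:
  assumes eq: "\<And>k. y k - green_sum y k = w k - green_sum w k"
  shows "y = w"
proof -
  define x where "x k = w k - green_sum w k" for k
  have contr: "N ((x k + green_sum y k) - (x k + green_sum w k)) \<le> q * c"
    if "\<And>j. N (y j - w j) \<le> c" for y w c k
    using green_sum_contraction[OF that] by simp
  have near: "N (y k - w k) \<le> p + p" for k
  proof -
    have "y k - w k = green_sum y k + - green_sum w k" using eq[of k] by (simp add: algebra_simps)
    then show ?thesis
      using vector_norm_triangle[OF norm, of "green_sum y k" "- green_sum w k"]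
        vector_norm_minus[OF norm, of "green_sum w k"] green_sum_bound[of y k] green_sum_bound[of w k]
      by simp
  qed
  have fixpoints: "(\<lambda>k. x k + green_sum y k) = y" "(\<lambda>k. x k + green_sum w k) = w"
    using eq by (auto simp: x_def fun_eq_iff algebra_simps)
  show ?thesis
    by (rule sup_contraction_fixpoint_unique[where T = "\<lambda>y k. x k + green_sum y k",
          OF norm q_nonneg q_less_1 _ fixpoints near]) (rule contr, assumption)
qed

lemma bij_linear_step: "bij (linear_step k)"
  by (rule bij_matrix_vector_mult[OF inv_A])

lemma bij_perturbed_step: "bij (perturbed_step k)"
  by (rule bij_lipschitz_perturbation[OF norm inv_A lipschitz gamma_nonneg invertible_step])

lemma continuous_on_perturbed_step: "continuous_on UNIV (perturbed_step k)"
  by (intro continuous_intros cont linear_continuous_on matrix_vector_mul_bounded_linear)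

text \<open>The correspondence \<open>y \<mapsto> y - green_sum y\<close> of solutions, read off pointwise.\<close>

definition linearize :: "nat \<Rightarrow> real ^ 'd \<Rightarrow> real ^ 'd" where
  "linearize k u = u - green_sum (solution_through perturbed_step k u) k"

lemma linearize_solution:
  "solution_on UNIV perturbed_step y \<Longrightarrow> linearize k (y k) = y k - green_sum y k"
  using solution_through_solution[of perturbed_step, OF bij_perturbed_step]
  by (simp add: linearize_def)

lemma solution_linearize:
  assumes "solution_on UNIV perturbed_step y"
  shows "solution_on UNIV linear_step (\<lambda>k. linearize k (y k))"
  using assms by (simp add: linearize_solution solution_perturbed_iff[symmetric])

lemma linear_solution_lifts:
  assumes "solution_on UNIV linear_step x"
  obtains y where "solution_on UNIV perturbed_step y" "\<And>k. linearize k (y k) = x k"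
proof -
  obtain y where y: "\<And>k. y k - green_sum y k = x k"
    by (rule green_equation_solvable[of x]) (rule that)
  with assms have sol: "solution_on UNIV perturbed_step y" by (simp add: solution_perturbed_iff)
  show ?thesis by (rule that[OF sol]) (simp add: linearize_solution[OF sol] y)
qed

text \<open>
  Injectivity: if two perturbed solutions have images that agree at one time, then these images,
  being solutions of the invertible linear system, agree at all times, and the uniqueness for the
  Green equation applies to whole sequences.
\<close>

lemma bij_linearize: "bij (linearize k)"
proof (rule bijI)
  show "inj (linearize k)"
  proof (rule injI)
    fix u v assume eq: "linearize k u = linearize k v"
    let ?y = "solution_through perturbed_step k u" and ?w = "solution_through perturbed_step k v"
    have at: "?y k = u" "?w k = v"
      by (simp_all add: solution_through_at[of perturbed_step, OF bij_perturbed_step])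
    have lin: "solution_on UNIV linear_step (\<lambda>j. linearize j (?y j))"
      "solution_on UNIV linear_step (\<lambda>j. linearize j (?w j))"
      by (rule solution_linearize, rule solution_on_solution_through)+
    have "(\<lambda>j. linearize j (?y j)) = (\<lambda>j. linearize j (?w j))"
      using solution_through_solution[of linear_step, OF bij_linear_step lin(1), of k]
        solution_through_solution[of linear_step, OF bij_linear_step lin(2), of k] eq
      by (simp add: at)
    then have "?y j - green_sum ?y j = ?w j - green_sum ?w j" for j
      by (simp add: linearize_solution solution_on_solution_through fun_eq_iff)
    then have "?y = ?w" by (rule green_equation_unique)
    then have "?y k = ?w k" by (rule fun_cong)
    then show "u = v" by (simp only: at)
  qed
  have "\<exists>u. v = linearize k u" for v
  proof -
    obtain y where "\<And>j. linearize j (y j) = solution_through linear_step k v j"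
      using linear_solution_lifts[OF solution_on_solution_through] by metis
    then have "linearize k (y k) = v"
      by (simp add: solution_through_at[of linear_step, OF bij_linear_step])
    then show ?thesis by blast
  qed
  then show "surj (linearize k)" by (simp add: surj_def)
qed

text \<open>
  For fixed \<^term>\<open>k\<close> the terms of the Green sum are dominated, independently of the point, by
  the summable sequence of weights with \<^term>\<open>\<mu>\<close>.
\<close>

lemma continuous_on_linearize: "continuous_on UNIV (linearize k)"
proof -
  let ?t = "\<lambda>j u. green A P Q k (j + 1) *v f j (solution_through perturbed_step k u j)"
  obtain c where c: "0 < c" "\<And>x. norm x \<le> c * N x" using norm_le_vector_norm[OF norm] by blast
  have dominated: "norm (?t j u) \<le> c * (induced_norm N (green A P Q k (j + 1)) * \<mu> j)" for j u
    using c(2)[of "?t j u"] mult_left_mono[OF green_term_bound, of c] c(1)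
    by (meson less_imp_le order_trans)
  have limit: "uniform_limit UNIV (\<lambda>n u. \<Sum>j<n. ?t j u) (\<lambda>u. \<Sum>j. ?t j u) sequentially"
    by (rule Weierstrass_m_test[OF dominated summable_mult[OF mu_summable]])
  have "continuous_on UNIV (?t j)" for j
    by (intro bounded_linear.continuous_on[OF matrix_vector_mul_bounded_linear]
        continuous_on_compose2[OF cont] continuous_on_solution_through
        continuous_on_perturbed_step bij_perturbed_step) simp
  then have partial_sums: "continuous_on UNIV (\<lambda>u. \<Sum>j<n. ?t j u)" for n
    by (rule continuous_on_sum)
  have "continuous_on UNIV (\<lambda>u. \<Sum>j. ?t j u)"
    by (rule uniform_limit_theorem[OF _ limit sequentially_bot])
      (intro always_eventually allI partial_sums)
  then show ?thesis unfolding linearize_def green_sum_def by (intro continuous_intros)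
qed

lemma conjugating_map_linearize:
  "conjugating_map N (UNIV :: nat set) perturbed_step linear_step linearize"
  unfolding conjugating_map_def
proof (intro conjI allI impI ballI)
  show "\<exists>B. \<forall>k\<in>UNIV. \<forall>u. N (linearize k u - u) \<le> B"
    using green_sum_bound by (auto simp: linearize_def vector_norm_minus[OF norm] intro!: exI[of _ p])
  show "\<exists>g. homeomorphism UNIV UNIV (linearize k) g" for k
    using continuous_bij_homeomorphism[OF continuous_on_linearize bij_linearize] by blast
qed (rule solution_linearize)

lemma conjugating_map_inv_linearize:
  "conjugating_map N (UNIV :: nat set) linear_step perturbed_step (\<lambda>k. inv (linearize k))"
  unfolding conjugating_map_def
proof (intro conjI allI impI ballI)
  fix x assume "solution_on (UNIV :: nat set) linear_step x"
  then obtain y where y: "solution_on UNIV perturbed_step y" "\<And>k. linearize k (y k) = x k"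
    using linear_solution_lifts by blast
  have "inv (linearize k) (x k) = y k" for k
    using y(2)[of k] bij_linearize[of k] by (metis bij_def inv_f_f)
  with y(1) show "solution_on UNIV perturbed_step (\<lambda>k. inv (linearize k) (x k))" by simp
next
  have "N (inv (linearize k) v - v) \<le> p" for k v
  proof -
    obtain u where u: "v = linearize k u" using bij_is_surj[OF bij_linearize, of k] by (rule surjE)
    then have "inv (linearize k) v - v = u - linearize k u"
      using bij_linearize[of k] by (simp add: bij_def inv_f_f)
    then show ?thesis using green_sum_bound by (simp add: linearize_def)
  qed
  then show "\<exists>B. \<forall>k\<in>UNIV. \<forall>u. N (inv (linearize k) u - u) \<le> B" by blast
next
  show "\<exists>g. homeomorphism UNIV UNIV (inv (linearize k)) g" for k
    using continuous_bij_homeomorphism[OF continuous_on_linearize bij_linearize]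
    by (auto intro: homeomorphism_symD)
qed

end

theorem theorem1:
  fixes N :: "real ^ 'd \<Rightarrow> real"
    and A P Q :: "nat \<Rightarrow> real ^ 'd ^ 'd"
    and f :: "nat \<Rightarrow> real ^ 'd \<Rightarrow> real ^ 'd"
    and M p q :: real
    and \<rho> h \<gamma> \<mu> :: "nat \<Rightarrow> real"
  assumes norm: "vector_norm N"
    and cont: "\<And>k. continuous_on UNIV (f k)"
    and P1_inv: "\<And>k. invertible (A k)"
    and P1_bdd: "bdd_above (range (\<lambda>k. induced_norm N (A k)))"
      "bdd_above (range (\<lambda>k. induced_norm N (matrix_inv (A k))))"
    and P1_M: "M \<ge> 1"
      "max (SUP k. induced_norm N (A k)) (SUP k. induced_norm N (matrix_inv (A k))) = M"
    and P2_proj: "invariant_projector A P" "invariant_projector A Q" "\<And>n. P n + Q n = mat 1"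
    and P2_rho: "\<And>n. 0 \<le> \<rho> n" "bounded (range \<rho>)"
    and P2_h: "decseq h" "\<And>n. 0 < h n" "h \<longlonglongrightarrow> 0" "h 0 = 1"
    and P2_stable: "\<And>k n. n \<le> k \<Longrightarrow>
      induced_norm N (transition A k n ** P n) \<le> \<rho> n * (h k / h n)"
    and P2_unstable: "\<And>k n. k \<le> n \<Longrightarrow>
      induced_norm N (transition A k n ** Q n) \<le> \<rho> n * (h n / h k)"
    and P3_nonneg: "\<And>k. 0 \<le> \<gamma> k" "\<And>k. 0 \<le> \<mu> k"
    and P3_lipschitz: "\<And>k y y'. N (f k y - f k y') \<le> \<gamma> k * N (y - y')"
    and P3_bound: "\<And>k y. N (f k y) \<le> \<mu> k"
    and P4: "\<And>l. summable (\<lambda>j. induced_norm N (green A P Q l (j + 1)) * \<mu> j)"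
      "\<And>l. (\<Sum>j. induced_norm N (green A P Q l (j + 1)) * \<mu> j) \<le> p"
    and P5: "\<And>l. summable (\<lambda>j. induced_norm N (green A P Q l (j + 1)) * \<gamma> j)"
      "\<And>l. (\<Sum>j. induced_norm N (green A P Q l (j + 1)) * \<gamma> j) \<le> q"
      "q < 1"
    and P6: "\<And>l. induced_norm N (matrix_inv (A l)) * \<gamma> l < 1"
  shows "topologically_equivalent N (UNIV :: nat set)
           (\<lambda>k x. A k *v x) (\<lambda>k y. A k *v y + f k y)"
proof -
  interpret green_perturbation N A P Q f p q \<gamma> \<mu>
    by unfold_locales (fact norm cont P1_inv P2_proj(3) P3_nonneg(1) P3_lipschitz P3_bound P4 P5 P6)+
  have "inv (inv (linearize k)) = linearize k" for k by (rule inv_inv_eq[OF bij_linearize])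
  then show ?thesis
    unfolding topologically_equivalent_def
    using conjugating_map_linearize conjugating_map_inv_linearize
    by (intro exI[of _ "\<lambda>k. inv (linearize k)"]) simp
qed

end
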